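(* Let $m$ be an odd integer with $m \geq 5$. Then the complete symmetric digraph $K^*_{2m}$ admits a $\vec{C}_m$-factorization, i.e. a resolvable decomposition into directed cycles of length $m$.
   Context: $K^*_n$ denotes the complete symmetric digraph on $n$ vertices: for any two distinct vertices $u,v$ both arcs $(u,v)$ and $(v,u)$ are present, and there are no loops. $\vec{C}_m$ denotes a directed cycle of length $m$. A $\vec{C}_m$-factor of a digraph $G$ is a spanning subdigraph of $G$ that is a disjoint union of directed $m$-cycles. A $\vec{C}_m$-factorization of $G$ is a partition of the arc set of $G$ into (arc sets of) $\vec{C}_m$-factors of $G$; equivalently a resolvable decomposition of $G$ into directed $m$-cycles. *)

theory Defs
  imports Main
begin

definition complete_sym_digraph :: "'a set \<Rightarrow> ('a \<times> 'a) set" where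
  "complete_sym_digraph V = {(u, v). u \<in> V \<and> v \<in> V \<and> u \<noteq> v}"

definition cycle_arcs :: "'a list \<Rightarrow> ('a \<times> 'a) set" where
  "cycle_arcs c = {(c ! i, c ! ((i + 1) mod length c)) | i. i < length c}"

definition is_dcycle :: "nat \<Rightarrow> 'a list \<Rightarrow> bool" where
  "is_dcycle m c \<longleftrightarrow> m \<ge> 2 \<and> length c = m \<and> distinct c"

definition is_Cm_factor :: "nat \<Rightarrow> 'a set \<Rightarrow> ('a \<times> 'a) set \<Rightarrow> ('a \<times> 'a) set \<Rightarrow> bool" where
  "is_Cm_factor m V A F \<longleftrightarrow>
     (\<exists>C :: 'a list set.
        (\<forall>c\<in>C. is_dcycle m c \<and> cycle_arcs c \<subseteq> A) \<and>
        (\<forall>c\<in>C. \<forall>d\<in>C. c \<noteq> d \<longrightarrow> set c \<inter> set d = {}) \<and>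
        (\<Union>c\<in>C. set c) = V \<and>
        F = (\<Union>c\<in>C. cycle_arcs c))"

definition has_Cm_factorization :: "nat \<Rightarrow> 'a set \<Rightarrow> ('a \<times> 'a) set \<Rightarrow> bool" where
  "has_Cm_factorization m V A \<longleftrightarrow>
     (\<exists>\<F> :: ('a \<times> 'a) set set.
        (\<forall>F\<in>\<F>. is_Cm_factor m V A F) \<and>
        (\<forall>F\<in>\<F>. \<forall>G\<in>\<F>. F \<noteq> G \<longrightarrow> F \<inter> G = {}) \<and>
        \<Union>\<F> = A)"

end

theory Submission
  imports Defs "HOL-Library.Multiset"
begin

text \<open>
  Let \<open>m = 2 * r + 1\<close>. The vertices are arranged in \<open>m\<close> columns with two levels each; the columns are
  the residues modulo \<open>2 * r\<close> and a point at infinity, and \<open>H\<^sub>0, \<dots>, H\<^sub>r\<^sub>-\<^sub>1\<close> are Walecki's zigzag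
  Hamiltonian cycles of the complete graph on the columns.

  If two directed Hamiltonian cycles of columns have no common arc and their union has a proper
  3-colouring, then the blow-up of their union splits into four factors: each one lifts the first
  cycle along a level function of the colours and the second cycle along the opposite function.
  An odd cycle traversed in both directions is such a pair, which settles \<open>H\<^sub>j\<close> for \<open>j \<ge> 2\<close>.

  The blow-up of \<open>H\<^sub>0 \<union> H\<^sub>1\<close> has to absorb the arcs inside the columns. For \<open>r \<ge> 5\<close> the reverse
  of \<open>H\<^sub>0\<close> and \<open>H\<^sub>1\<close> are again 3-colourable. What remains, namely \<open>H\<^sub>0\<close>, the reverse of \<open>H\<^sub>1\<close> and the
  arcs inside the columns, is a 5-regular digraph shaped like a strip of bounded width. Computer
  search gives five factors of it that can be lengthened periodically, by four columns at a time.
\<close>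

subsection \<open>Packings of factors\<close>

definition factor_arcs :: "'a list \<times> 'a list \<Rightarrow> ('a \<times> 'a) set" where
  "factor_arcs p = cycle_arcs (fst p) \<union> cycle_arcs (snd p)"

text \<open>On 2m vertices a factor into m-cycles has exactly two cycles, hence a pair of lists per
  factor. \<open>E\<close> bounds the arcs only from above; that every arc is used follows later by
  counting.\<close>

definition packing ::
  "nat \<Rightarrow> 'a set \<Rightarrow> ('a \<times> 'a) set \<Rightarrow> ('a list \<times> 'a list) list \<Rightarrow> bool" where
  "packing m V E fs \<longleftrightarrow>
     (\<forall>(c, d)\<in>set fs. length c = m \<and> length d = m \<and> distinct (c @ d) \<and> set (c @ d) = V \<and>
        factor_arcs (c, d) \<subseteq> E) \<and>
     sorted_wrt (\<lambda>p q. factor_arcs p \<inter> factor_arcs q = {}) fs"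

lemma packingI:
  assumes "\<And>c d. (c, d) \<in> set fs \<Longrightarrow>
      length c = m \<and> length d = m \<and> distinct (c @ d) \<and> set (c @ d) = V \<and> factor_arcs (c, d) \<subseteq> E"
    and "sorted_wrt (\<lambda>p q. factor_arcs p \<inter> factor_arcs q = {}) fs"
  shows "packing m V E fs"
  using assms unfolding packing_def by blast

lemma cycle_arcs_zip: "cycle_arcs c = set (zip c (rotate1 c))"
  by (auto simp: cycle_arcs_def set_zip nth_rotate1)

lemma cycle_arcs_image: "cycle_arcs c = (\<lambda>i. (c ! i, c ! ((i + 1) mod length c))) ` {..<length c}"
  by (auto simp: cycle_arcs_def)

lemma cycle_arcs_map: "cycle_arcs (map f c) = map_prod f f ` cycle_arcs c"
  unfolding cycle_arcs_zip rotate1_map zip_map_map by (simp add: map_prod_def)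

lemma cycle_arcs_subset: "cycle_arcs c \<subseteq> set c \<times> set c"
  unfolding cycle_arcs_zip using set_zip_leftD set_zip_rightD by fastforce

lemma card_cycle_arcs:
  assumes "distinct c"
  shows "card (cycle_arcs c) = length c"
  unfolding cycle_arcs_image
  by (subst card_image) (use assms in \<open>auto simp: inj_on_def nth_eq_iff_index_eq\<close>)

lemma finite_cycle_arcs: "finite (cycle_arcs c)"
  by (simp add: cycle_arcs_image)

lemma cycle_arcs_irrefl:
  assumes "distinct c" "length c \<ge> 2" "(u, v) \<in> cycle_arcs c"
  shows "u \<noteq> v"
proof
  assume "u = v"
  obtain i where i: "i < length c" "u = c ! i" "v = c ! ((i + 1) mod length c)"
    using assms(3) by (auto simp: cycle_arcs_def)
  have "(i + 1) mod length c < length c" using i(1) by (intro mod_less_divisor) linarith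
  then have "(i + 1) mod length c = i"
    using \<open>u = v\<close> i assms(1) by (metis nth_eq_iff_index_eq)
  then show False using i assms(2) by (cases "i + 1 = length c") auto
qed

text \<open>The indices of \<open>u\<close> and \<open>v\<close> would each succeed the other modulo
  the length, so the length would divide 2. It makes a cycle arc-disjoint from its reverse.\<close>

lemma cycle_arcs_asym:
  assumes "distinct c" "length c \<ge> 3" "(u, v) \<in> cycle_arcs c"
  shows "(v, u) \<notin> cycle_arcs c"
proof
  assume "(v, u) \<in> cycle_arcs c"
  let ?n = "length c"
  obtain i where i: "i < ?n" "u = c ! i" "v = c ! ((i + 1) mod ?n)"
    using assms(3) by (auto simp: cycle_arcs_def)
  obtain j where j: "j < ?n" "v = c ! j" "u = c ! ((j + 1) mod ?n)"
    using \<open>(v, u) \<in> cycle_arcs c\<close> by (auto simp: cycle_arcs_def)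
  have "(i + 1) mod ?n < ?n" "(j + 1) mod ?n < ?n" using i(1) by (intro mod_less_divisor; linarith)+
  then have "(i + 1) mod ?n = j" "(j + 1) mod ?n = i"
    using i j assms(1) by (metis nth_eq_iff_index_eq)+
  then show False
    using i j assms(2) by (cases "i + 1 = ?n"; cases "j + 1 = ?n") auto
qed

lemma cycle_arcs_rev: "cycle_arcs (rev c) \<subseteq> (cycle_arcs c)\<inverse>"
proof
  fix p assume "p \<in> cycle_arcs (rev c)"
  then obtain i where i: "i < length c" "p = (rev c ! i, rev c ! ((i + 1) mod length c))"
    by (auto simp: cycle_arcs_def)
  show "p \<in> (cycle_arcs c)\<inverse>"
  proof (cases "i + 1 = length c")
    case True
    \<comment> \<open>The closing arc of \<open>rev c\<close> is the closing arc of \<open>c\<close>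
      turned round.\<close>
    then have "p = (c ! 0, c ! (length c - 1))"
      using i by (auto simp: rev_nth simp flip: True)
    moreover have "(c ! (length c - 1), c ! 0) \<in> cycle_arcs c"
      using True unfolding cycle_arcs_def
      by (auto intro!: exI[of _ "length c - 1"] simp flip: True)
    ultimately show ?thesis by simp
  next
    case False
    then have "p = (c ! (length c - 2 - i + 1), c ! (length c - 2 - i))"
      using i by (auto simp: rev_nth Suc_diff_Suc numeral_2_eq_2)
    moreover have "(c ! (length c - 2 - i), c ! (length c - 2 - i + 1)) \<in> cycle_arcs c"
      using i False unfolding cycle_arcs_def
      by (auto intro!: exI[of _ "length c - 2 - i"])
    ultimately show ?thesis by simp
  qed
qed

lemma factor_arcs_subset: "factor_arcs (c, d) \<subseteq> set (c @ d) \<times> set (c @ d)"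
  using cycle_arcs_subset[of c] cycle_arcs_subset[of d] by (auto simp: factor_arcs_def)

lemma packing_append:
  assumes "packing m V E fs" "packing m V E' gs" "E \<inter> E' = {}"
  shows "packing m V (E \<union> E') (fs @ gs)"
proof -
  have "factor_arcs p \<inter> factor_arcs q = {}" if "p \<in> set fs" "q \<in> set gs" for p q
  proof -
    have "factor_arcs p \<subseteq> E" "factor_arcs q \<subseteq> E'"
      using assms(1,2) that by (auto simp: packing_def split_beta)
    then show ?thesis using assms(3) by blast
  qed
  then show ?thesis
    using assms by (auto simp: packing_def sorted_wrt_append split_beta)
qed

lemma packing_mono: "packing m V E fs \<Longrightarrow> E \<subseteq> E' \<Longrightarrow> packing m V E' fs"
  by (auto simp: packing_def split_beta)

lemma packing_concat:
  assumes "\<And>j. j \<in> set js \<Longrightarrow> packing m V (E j) (g j)" "distinct js"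
    and "\<And>i j. i \<noteq> j \<Longrightarrow> E i \<inter> E j = {}"
  shows "packing m V (\<Union>j\<in>set js. E j) (concat (map g js))"
  using assms(1,2)
proof (induction js)
  case Nil
  then show ?case by (simp add: packing_def)
next
  case (Cons j js)
  have "E j \<inter> E i = {}" if "i \<in> set js" for i
    using Cons.prems(2) that by (intro assms(3)) auto
  then have "E j \<inter> (\<Union>i\<in>set js. E i) = {}"
    by blast
  then show ?case
    using packing_append[of m V "E j" "g j"] Cons by simp
qed

text \<open>All arcs of the factors lie in V x V, whatever \<open>E\<close> is, so injectivity on
  \<open>V\<close> keeps the images of disjoint factors disjoint.\<close>

lemma packing_map:
  assumes "packing m V E fs" "inj_on f V"
  shows "packing m (f ` V) (map_prod f f ` E) (map (map_prod (map f) (map f)) fs)"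
proof -
  have arcs: "factor_arcs (map_prod (map f) (map f) p) = map_prod f f ` factor_arcs p" for p
    by (cases p) (auto simp: factor_arcs_def cycle_arcs_map image_Un)
  have sub: "factor_arcs p \<subseteq> V \<times> V" if "p \<in> set fs" for p
    using that assms(1) factor_arcs_subset[of "fst p" "snd p"] by (auto simp: packing_def split_beta)
  have inj: "inj_on (map_prod f f) (V \<times> V)"
    using assms(2) by (auto simp: inj_on_def)
  have "map_prod f f ` factor_arcs p \<inter> map_prod f f ` factor_arcs q = {}"
    if "p \<in> set fs" "q \<in> set fs" "factor_arcs p \<inter> factor_arcs q = {}" for p q
    using inj_on_image_Int[OF inj sub[OF that(1)] sub[OF that(2)]] that(3) by simp
  then have "sorted_wrt (\<lambda>p q. factor_arcs p \<inter> factor_arcs q = {}) (map (map_prod (map f) (map f)) fs)"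
    unfolding sorted_wrt_map arcs
    by (rule sorted_wrt_mono_rel[of fs "\<lambda>p q. factor_arcs p \<inter> factor_arcs q = {}"])
      (use assms(1) in \<open>simp_all add: packing_def\<close>)
  moreover have "length c' = m \<and> length d' = m \<and> distinct (c' @ d') \<and>
      set (c' @ d') = f ` V \<and> factor_arcs (c', d') \<subseteq> map_prod f f ` E"
    if mem: "(c', d') \<in> set (map (map_prod (map f) (map f)) fs)" for c' d'
  proof -
    obtain c d where that: "(c, d) \<in> set fs" "c' = map f c" "d' = map f d"
      using mem by auto
    have *: "length c = m" "length d = m" "distinct (c @ d)" "set (c @ d) = V" "factor_arcs (c, d) \<subseteq> E"
      using that(1) assms(1) by (auto simp: packing_def)
    have "distinct (map f (c @ d))" using *(3) assms(2) unfolding distinct_map *(4) by simp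
    moreover have "set (map f (c @ d)) = f ` V" using *(4) by (metis list.set_map)
    ultimately show ?thesis using * that(2,3) arcs[of "(c, d)"] by auto
  qed
  ultimately show ?thesis by (intro packingI)
qed

lemma card_complete_sym_digraph:
  assumes "finite V"
  shows "finite (complete_sym_digraph V)" "card (complete_sym_digraph V) = card V * (card V - 1)"
proof -
  have eq: "complete_sym_digraph V = V \<times> V - (\<lambda>x. (x, x)) ` V"
    by (auto simp: complete_sym_digraph_def)
  show "finite (complete_sym_digraph V)" using assms by (simp add: eq)
  have "card ((\<lambda>x. (x, x)) ` V) = card V" by (simp add: card_image inj_on_def)
  then show "card (complete_sym_digraph V) = card V * (card V - 1)"
    unfolding eq using assms
    by (subst card_Diff_subset) (auto simp: card_cartesian_product algebra_simps diff_mult_distrib2)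
qed

text \<open>Covering all arcs comes for free: \<^term>\<open>2 * m - 1\<close> disjoint factors use as many arcs as
  the complete digraph has.\<close>

lemma packing_imp_factorization:
  assumes "packing m V E fs" "length fs = 2 * m - 1" "m \<ge> 2" "finite V" "card V = 2 * m"
  shows "has_Cm_factorization m V (complete_sym_digraph V)"
proof -
  let ?A = "complete_sym_digraph V"
  have fs: "length c = m" "length d = m" "distinct c" "distinct d" "set c \<inter> set d = {}" "set c \<union> set d = V"
    if "(c, d) \<in> set fs" for c d
    using that assms(1) by (auto simp: packing_def)
  have sub: "cycle_arcs c \<subseteq> ?A" "cycle_arcs d \<subseteq> ?A" if "(c, d) \<in> set fs" for c d
  proof -
    have "cycle_arcs x \<subseteq> ?A" if "length x = m" "distinct x" "set x \<subseteq> V" for x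
      using that assms(3) cycle_arcs_irrefl[of x] cycle_arcs_subset[of x]
      by (fastforce simp: complete_sym_digraph_def)
    then show "cycle_arcs c \<subseteq> ?A" "cycle_arcs d \<subseteq> ?A" using fs[OF that] by auto
  qed
  have factor: "is_Cm_factor m V ?A (factor_arcs p)" if "p \<in> set fs" for p
  proof -
    obtain c d where p: "p = (c, d)" by (cases p)
    show ?thesis
      unfolding is_Cm_factor_def
      by (rule exI[of _ "{c, d}"])
        (use fs[of c d] sub[of c d] that p assms(3) in
          \<open>auto simp: is_dcycle_def factor_arcs_def\<close>)
  qed
  have disj: "factor_arcs (fs ! i) \<inter> factor_arcs (fs ! j) = {}"
    if "i < length fs" "j < length fs" "i \<noteq> j" for i j
  proof -
    have sorted: "sorted_wrt (\<lambda>p q. factor_arcs p \<inter> factor_arcs q = {}) fs"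
      using assms(1) by (simp add: packing_def)
    show ?thesis
      using sorted_wrt_nth_less[OF sorted, of i j] sorted_wrt_nth_less[OF sorted, of j i] that
      by (cases i j rule: linorder_cases) (simp_all add: Int_commute)
  qed
  have card: "card (factor_arcs p) = 2 * m" if "p \<in> set fs" for p
  proof -
    obtain c d where p: "p = (c, d)" by (cases p)
    have "set c \<times> set c \<inter> set d \<times> set d = {}" using fs[of c d] that p by auto
    then have "cycle_arcs c \<inter> cycle_arcs d = {}"
      using cycle_arcs_subset[of c] cycle_arcs_subset[of d] by blast
    then show ?thesis
      using fs[of c d] that p
      by (simp add: factor_arcs_def card_Un_disjoint finite_cycle_arcs card_cycle_arcs)
  qed
  have "card (\<Union>i\<in>{..<length fs}. factor_arcs (fs ! i)) = (\<Sum>i<length fs. card (factor_arcs (fs ! i)))"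
    by (rule card_UN_disjoint) (use disj in \<open>auto simp: factor_arcs_def finite_cycle_arcs\<close>)
  also have "\<dots> = (\<Sum>i<length fs. 2 * m)"
    by (intro sum.cong refl card) simp
  \<comment> \<open>Both sides are (2m - 1) * 2m.\<close>
  also have "\<dots> = card ?A"
    using assms(2) by (simp add: card_complete_sym_digraph(2)[OF assms(4)] assms(5))
  finally have "card (\<Union>i\<in>{..<length fs}. factor_arcs (fs ! i)) = card ?A" .
  moreover have "factor_arcs p \<subseteq> ?A" if "p \<in> set fs" for p
    using sub[of "fst p" "snd p"] that by (simp add: factor_arcs_def)
  then have "(\<Union>i\<in>{..<length fs}. factor_arcs (fs ! i)) \<subseteq> ?A"
    by (intro UN_least) simp
  ultimately have "(\<Union>i\<in>{..<length fs}. factor_arcs (fs ! i)) = ?A"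
    using assms(4) by (simp add: card_subset_eq card_complete_sym_digraph(1))
  moreover have "set fs = (!) fs ` {..<length fs}"
    by (auto simp: set_conv_nth)
  ultimately have "\<Union> (factor_arcs ` set fs) = ?A"
    by (simp add: image_image)
  moreover have "factor_arcs p \<inter> factor_arcs q = {}"
    if pq: "p \<in> set fs" "q \<in> set fs" "factor_arcs p \<noteq> factor_arcs q" for p q
  proof -
    obtain i j where "i < length fs" "j < length fs" "p = fs ! i" "q = fs ! j"
      using pq(1,2) by (auto simp: in_set_conv_nth)
    then show ?thesis using pq(3) disj[of i j] by (cases "i = j") simp_all
  qed
  ultimately show ?thesis
    unfolding has_Cm_factorization_def
    by (intro exI[of _ "factor_arcs ` set fs"]) (use factor in blast)
qed

section \<open>Lifting two properly 3-coloured cycles to the blow-up\<close>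

text \<open>For i = 0, 1, 2, 3 the levels of the colours 0, 1, 2 are 000, 011, 101, 110: the binary
  words of even weight. Any two positions determine the third, so this is an orthogonal array of
  strength 2.\<close>

fun level :: "nat \<Rightarrow> nat \<Rightarrow> bool" where
  "level i 0 \<longleftrightarrow> i \<ge> 2"
| "level i (Suc 0) \<longleftrightarrow> i = 1 \<or> i = 3"
| "level i (Suc (Suc c)) \<longleftrightarrow> i = 1 \<or> i = 2"

lemma level_inj:
  assumes "i < 4" "j < 4" "a < 3" "b < 3" "a \<noteq> b" "level i a = level j a" "level i b = level j b"
  shows "i = j"
proof -
  have "i \<in> {0, 1, 2, 3}" "j \<in> {0, 1, 2, 3}" "a \<in> {0, 1, 2}" "b \<in> {0, 1, 2}"
    using assms(1-4) by auto
  then show ?thesis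
    using assms(5-7) by (auto simp: numeral_2_eq_2)
qed

text \<open>For two different colours \<open>a, b\<close> the four pairs \<^term>\<open>(level i a, level i b)\<close>
  are all pairs of levels, so the lifts of a properly coloured arc along the four level functions
  are its four copies in the blow-up.\<close>

lemma packing_two_cycles:
  fixes h g :: "'a list" and col :: "'a \<Rightarrow> nat"
  assumes h: "length h = m" "distinct h" "set h = W"
    and g: "length g = m" "distinct g" "set g = W"
    and disj: "cycle_arcs h \<inter> cycle_arcs g = {}"
    and col: "\<And>x. col x < 3" "\<And>u v. (u, v) \<in> cycle_arcs h \<union> cycle_arcs g \<Longrightarrow> col u \<noteq> col v"
  shows "\<exists>fs. length fs = 4 \<and>
    packing m (W \<times> (UNIV :: bool set)) {((u, a), (v, b)). (u, v) \<in> cycle_arcs h \<union> cycle_arcs g} fs"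
proof -
  define up where "up i x = (x, level i (col x))" for i :: nat and x :: 'a
  \<comment> \<open>With complementary levels the two lifted cycles are vertex-disjoint and together
    cover both levels of every column.\<close>
  define dn where "dn i x = (x, \<not> level i (col x))" for i :: nat and x :: 'a
  define F where "F i = (map (up i) h, map (dn i) g)" for i
  have arcs: "factor_arcs (F i) = map_prod (up i) (up i) ` cycle_arcs h \<union> map_prod (dn i) (dn i) `
    cycle_arcs g" for i
    by (simp add: factor_arcs_def F_def cycle_arcs_map)
  \<comment> \<open>As \<open>h\<close> and \<open>g\<close> are arc-disjoint, a common arc comes
    from the same kind of lift on both sides; its two differently coloured ends then determine the
    index.\<close>
  have eq: "i = j"
    if "i < 4" "j < 4" and p: "p \<in> factor_arcs (F i)" "p \<in> factor_arcs (F j)" for i j p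
  proof -
    obtain u a v b where uv: "p = ((u, a), (v, b))" by (metis prod.collapse)
    have "(u, v) \<in> cycle_arcs h \<and> a = level k (col u) \<and> b = level k (col v) \<or>
        (u, v) \<in> cycle_arcs g \<and> a = (\<not> level k (col u)) \<and> b = (\<not> level k (col v))"
      if "p \<in> factor_arcs (F k)" for k
      using that unfolding arcs uv by (auto simp: up_def dn_def)
    from this[OF p(1)] this[OF p(2)]
    have "(u, v) \<in> cycle_arcs h \<union> cycle_arcs g" "level i (col u) = level j (col u)"
        "level i (col v) = level j (col v)"
      using disj by auto
    then show ?thesis
      using level_inj[of i j "col u" "col v"] that(1,2) col by blast
  qed
  have disj': "factor_arcs (F i) \<inter> factor_arcs (F j) = {}" if "i < j" "j < 4" for i j
  proof (rule ccontr)
    assume "factor_arcs (F i) \<inter> factor_arcs (F j) \<noteq> {}"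
    then obtain p where "p \<in> factor_arcs (F i)" "p \<in> factor_arcs (F j)" by blast
    then show False using eq[of i j p] that by simp
  qed
  have "sorted_wrt (\<lambda>p q. factor_arcs p \<inter> factor_arcs q = {}) (map F [0..<4])"
    unfolding sorted_wrt_map
    by (rule sorted_wrt_mono_rel[of _ "(<)"]) (simp_all add: disj')
  moreover have "length (map (up i) h) = m \<and> length (map (dn i) g) = m \<and>
      distinct (map (up i) h @ map (dn i) g) \<and> set (map (up i) h @ map (dn i) g) = W \<times> UNIV \<and>
      factor_arcs (F i) \<subseteq> {((u, a), (v, b)). (u, v) \<in> cycle_arcs h \<union> cycle_arcs g}" for i
    using h g unfolding arcs
    by (auto simp: distinct_map inj_on_def up_def dn_def image_iff)
  ultimately have "packing m (W \<times> UNIV) {((u, a), (v, b)). (u, v) \<in> cycle_arcs h \<union> cycle_arcs g}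
    (map F [0..<4])"
    by (auto simp: packing_def F_def)
  then show ?thesis by (intro exI[of _ "map F [0..<4]"]) simp
qed

section \<open>Packings from duplicate-free arc lists\<close>

definition arc_list :: "'a list \<times> 'a list \<Rightarrow> ('a \<times> 'a) list" where
  "arc_list = (\<lambda>(c, d). zip c (rotate1 c) @ zip d (rotate1 d))"

lemma factor_arcs_arc_list: "factor_arcs p = set (arc_list p)"
  by (simp add: factor_arcs_def arc_list_def cycle_arcs_zip split_beta)

text \<open>Pairwise disjointness of the factors is reduced to distinctness of one list, which can
  be evaluated or read off from a multiset.\<close>

lemma packing_arc_listI:
  assumes "\<And>c d. (c, d) \<in> set fs \<Longrightarrow>
      length c = m \<and> length d = m \<and> distinct (c @ d) \<and> set (c @ d) = V"
    and "distinct (concat (map arc_list fs))"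
    and "set (concat (map arc_list fs)) \<subseteq> E"
  shows "packing m V E fs"
proof -
  have "sorted_wrt (\<lambda>p q. factor_arcs p \<inter> factor_arcs q = {}) fs"
    using assms(2)
  proof (induction fs)
    case (Cons p fs)
    then show ?case by (fastforce simp: factor_arcs_arc_list)
  qed simp
  moreover have "factor_arcs (c, d) \<subseteq> E" if "(c, d) \<in> set fs" for c d
    using assms(3) that by (auto simp: factor_arcs_arc_list)
  ultimately show ?thesis
    using assms(1) by (intro packingI) auto
qed

subsection \<open>Walecki's Hamiltonian cycles\<close>

text \<open>The columns are the numbers up to \<^term>\<open>2 * r\<close>, where \<^term>\<open>2 * r\<close> itself stands for the
  point at infinity. The label of an edge is the index of the Walecki cycle through it.\<close>

definition label :: "nat \<Rightarrow> nat \<Rightarrow> nat \<Rightarrow> nat" where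
  "label r x y =
     (if x = 2 * r then y mod r else if y = 2 * r then x mod r else ((x + y) mod (2 * r)) div 2)"

lemma label_commute: "label r x y = label r y x"
  by (auto simp: label_def add.commute)

text \<open>The sequence j, j+1, j-1, j+2, j-2, ..., j+r modulo 2r. The summand \<open>2 * r\<close>
  keeps the natural subtraction from truncating.\<close>

definition zigzag :: "nat \<Rightarrow> nat \<Rightarrow> nat \<Rightarrow> nat" where
  "zigzag r j i = (if even i then j + 2 * r - i div 2 else j + (i + 1) div 2) mod (2 * r)"

definition walecki :: "nat \<Rightarrow> nat \<Rightarrow> nat list" where
  "walecki r j = map (zigzag r j) [0..<2 * r] @ [2 * r]"

lemma inj_on_mod: "inj_on (\<lambda>x :: nat. x mod n) {a + 1..a + n}"
proof -
  have *: "x = y" if "x \<in> {a + 1..a + n}" "y \<in> {a + 1..a + n}" "x mod n = y mod n" "x \<le> y" for x y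
  proof -
    have "n dvd y - x" using that by (metis mod_eq_dvd_iff_nat)
    moreover have "y - x < n" using that by auto
    ultimately show ?thesis using that(4) by (metis nat_dvd_not_less diff_is_0_eq le_antisym not_gr_zero)
  qed
  show ?thesis
    by (rule inj_onI) (metis * nat_le_linear)
qed

text \<open>Before reduction, odd positions give j+1, ..., j+r and even ones j+r+1, ..., j+2r:
  together 2r consecutive numbers.\<close>

lemma inj_on_zigzag: "inj_on (zigzag r j) {..<2 * r}"
proof -
  let ?f = "\<lambda>i. if even i then j + 2 * r - i div 2 else j + (i + 1) div 2"
  have "inj_on ?f {..<2 * r}"
    by (auto simp: inj_on_def elim!: evenE oddE split: if_splits)
  moreover have "?f ` {..<2 * r} \<subseteq> {j + 1..j + 2 * r}"
    by (auto elim!: evenE oddE)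
  then have "inj_on (\<lambda>x. x mod (2 * r)) (?f ` {..<2 * r})"
    by (rule inj_on_subset[OF inj_on_mod])
  ultimately have "inj_on ((\<lambda>x. x mod (2 * r)) \<circ> ?f) {..<2 * r}"
    by (rule comp_inj_on)
  then show ?thesis
    by (simp add: zigzag_def[abs_def] comp_def)
qed

lemma zigzag_less: "r > 0 \<Longrightarrow> zigzag r j i < 2 * r"
  by (simp add: zigzag_def)

lemma walecki:
  assumes "r > 0"
  shows "length (walecki r j) = 2 * r + 1" "distinct (walecki r j)" "set (walecki r j) = {..2 * r}"
proof -
  show len: "length (walecki r j) = 2 * r + 1"
    by (simp add: walecki_def)
  show dist: "distinct (walecki r j)"
  proof -
    have "2 * r \<notin> zigzag r j ` {..<2 * r}"
      using zigzag_less[OF assms, of j] by (metis imageE less_irrefl)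
    then show ?thesis
      using inj_on_zigzag[of r j] by (simp add: walecki_def distinct_map atLeast0LessThan)
  qed
  have "set (walecki r j) \<subseteq> {..2 * r}"
    using zigzag_less[OF assms, of j] by (auto simp: walecki_def intro: less_imp_le)
  then show "set (walecki r j) = {..2 * r}"
    using len dist by (intro card_subset_eq) (simp_all add: distinct_card)
qed

lemma nth_walecki: "i < 2 * r \<Longrightarrow> walecki r j ! i = zigzag r j i" "walecki r j ! (2 * r) = 2 * r"
  by (auto simp: walecki_def nth_append)

lemma cycle_arcs_walecki:
  assumes "r > 0"
  shows "cycle_arcs (walecki r j) =
    {(zigzag r j i, zigzag r j (i + 1)) | i. i + 1 < 2 * r} \<union>
    {(zigzag r j (2 * r - 1), 2 * r), (2 * r, zigzag r j 0)}"
    (is "_ = ?R")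
proof -
  have "{..<2 * r + 1} = {i. i + 1 < 2 * r} \<union> {2 * r - 1, 2 * r}"
    using assms by auto
  moreover have "walecki r j ! (2 * r - 1) = zigzag r j (2 * r - 1)"
    "walecki r j ! 0 = zigzag r j 0"
    using assms by (simp_all add: nth_walecki)
  moreover have "(2 * r - 1 + 1) mod (2 * r + 1) = 2 * r"
    using assms by simp
  ultimately show ?thesis
    unfolding cycle_arcs_image walecki(1)[OF assms] image_Un
    by (auto simp: nth_walecki image_def)
qed

text \<open>The offsets from \<open>j\<close> nearly cancel between neighbours. The sums 2j and 2j+1
  modulo 2r occur for no other index below \<open>r\<close>, which makes the zigzags
  edge-disjoint.\<close>

lemma zigzag_sum:
  assumes "r > 0" "i + 1 < 2 * r"
  shows "(zigzag r j i + zigzag r j (i + 1)) mod (2 * r) = (if even i then 2 * j + 1 else 2 * j) mod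
    (2 * r)"
proof (cases "even i")
  case True
  then obtain p where p: "i = 2 * p" by (auto elim: evenE)
  have "j + 2 * r - p + (j + (p + 1)) = 2 * j + 1 + 2 * r" using p assms by auto
  moreover have "(2 * j + 1 + 2 * r) mod (2 * r) = (2 * j + 1) mod (2 * r)" by (rule mod_add_self2)
  ultimately have "(j + 2 * r - p + (j + (p + 1))) mod (2 * r) = (2 * j + 1) mod (2 * r)"
    by (simp only:)
  then show ?thesis
    using p by (simp add: zigzag_def mod_add_eq)
next
  case False
  then obtain p where p: "i = 2 * p + 1" by (auto elim: oddE)
  have "j + (p + 1) + (j + 2 * r - (p + 1)) = 2 * j + 2 * r" using p assms by auto
  moreover have "(2 * j + 2 * r) mod (2 * r) = (2 * j) mod (2 * r)" by (rule mod_add_self2)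
  ultimately have "(j + (p + 1) + (j + 2 * r - (p + 1))) mod (2 * r) = (2 * j) mod (2 * r)"
    by (simp only:)
  then show ?thesis
    using p by (simp add: zigzag_def mod_add_eq)
qed

text \<open>A finite edge has sum 2j or 2j+1 modulo 2r, which halves to \<open>j\<close>. The
  neighbours of infinity are j+r and j, both congruent to \<open>j\<close> modulo
  \<open>r\<close>.\<close>

lemma label_walecki:
  assumes "j < r" "(x, y) \<in> cycle_arcs (walecki r j)"
  shows "label r x y = j"
proof -
  have r: "r > 0" using assms by simp
  consider i where "i + 1 < 2 * r" "x = zigzag r j i" "y = zigzag r j (i + 1)"
    | "x = zigzag r j (2 * r - 1)" "y = 2 * r" | "x = 2 * r" "y = zigzag r j 0"
    using assms(2) unfolding cycle_arcs_walecki[OF r] by blast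
  then show ?thesis
  proof cases
    case 1
    have "(x + y) mod (2 * r) = (if even i then 2 * j + 1 else 2 * j)"
      using zigzag_sum[OF r 1(1), of j] 1 assms(1) by auto
    moreover have "x < 2 * r" "y < 2 * r" using 1 zigzag_less[OF r] by auto
    ultimately show ?thesis by (auto simp: label_def)
  next
    case 2
    have "odd (2 * r - 1)" "(2 * r - 1 + 1) div 2 = r" using r by auto
    then have "x = (j + r) mod (2 * r)" using 2 by (simp add: zigzag_def)
    moreover have "(j + r) mod (2 * r) mod r = j"
      using assms(1) by (simp add: mod_mod_cancel)
    moreover have "x \<noteq> 2 * r" using 2 zigzag_less[OF r, of j "2 * r - 1"] by auto
    ultimately show ?thesis using 2 by (simp add: label_def)
  next
    case 3
    then have "y = j" using assms(1) by (simp add: zigzag_def)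
    then show ?thesis using 3 assms(1) by (simp add: label_def)
  qed
qed

lemma packing_walecki:
  assumes "j < r"
  shows "\<exists>fs. length fs = 4 \<and> packing (2 * r + 1) ({..2 * r} \<times> (UNIV :: bool set))
    {((u, a), (v, b)). u \<noteq> v \<and> label r u v = j} fs"
proof -
  have r: "r > 0" using assms by simp
  let ?h = "walecki r j"
  \<comment> \<open>Colours alternate along the zigzag path, \<open>inv_into\<close> recovering the
    position; infinity takes the third colour and closes the odd cycle.\<close>
  define col where "col x = (if x < 2 * r then inv_into {..<2 * r} (zigzag r j) x mod 2 else 2)" for x
  have col_zigzag: "col (zigzag r j i) = i mod 2" if "i < 2 * r" for i
    using that inj_on_zigzag[of r j] zigzag_less[OF r] by (simp add: col_def inv_into_f_f)
  have col_inf: "col (2 * r) = 2" by (simp add: col_def)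
  have col_neq: "col u \<noteq> col v" if "(u, v) \<in> cycle_arcs ?h" for u v
  proof -
    have "i mod 2 \<noteq> Suc i mod 2" "i mod 2 \<noteq> 2" for i :: nat
      by presburger+
    then show ?thesis
      using that r unfolding cycle_arcs_walecki[OF r] by (auto simp: col_zigzag col_inf)
  qed
  have irrefl: "u \<noteq> v" if "(u, v) \<in> cycle_arcs ?h" for u v
    using that cycle_arcs_irrefl[of ?h u v] walecki[OF r, of j] r by simp
  have asym: "cycle_arcs ?h \<inter> cycle_arcs (rev ?h) = {}"
    using cycle_arcs_asym[of ?h] cycle_arcs_rev[of ?h] walecki[OF r, of j] r by fastforce
  have "y mod 2 < 3" for y :: nat by presburger
  then have col3: "col x < 3" for x by (simp add: col_def)
  have col_neq': "col u \<noteq> col v" if "(u, v) \<in> cycle_arcs ?h \<union> cycle_arcs (rev ?h)" for u v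
    using that col_neq[of u v] col_neq[of v u] cycle_arcs_rev[of ?h] by auto
  have "\<exists>fs. length fs = 4 \<and> packing (2 * r + 1) ({..2 * r} \<times> (UNIV :: bool set))
    {((u, a), (v, b)). (u, v) \<in> cycle_arcs ?h \<union> cycle_arcs (rev ?h)} fs"
    by (rule packing_two_cycles[OF _ _ _ _ _ _ asym col3 col_neq']) (simp_all add: walecki[OF r])
  moreover have "{((u, a :: bool), (v, b :: bool)). (u, v) \<in> cycle_arcs ?h \<union> cycle_arcs (rev ?h)}
      \<subseteq> {((u, a), (v, b)). u \<noteq> v \<and> label r u v = j}"
    using irrefl label_walecki[OF assms] label_commute[of r] cycle_arcs_rev[of ?h] by fastforce
  ultimately show ?thesis by (meson packing_mono)
qed
subsection \<open>The strip\<close>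

text \<open>In the strip the columns \<open>i + 1\<close> and \<open>-i\<close> (modulo \<open>2 * r\<close>) are called \<open>A\<close> and \<open>B\<close>, with
  their two levels as index, and \<open>I\<close> is the column at infinity.\<close>

datatype vert = A0 nat | A1 nat | B0 nat | B1 nat | I0 | I1

text \<open>Multisets make arcs additive under joining of paths, and one equation then records
  disjointness and exhaustion together.\<close>

fun path_arcs :: "'a list \<Rightarrow> ('a \<times> 'a) multiset" where
  "path_arcs [] = {#}"
| "path_arcs [x] = {#}"
| "path_arcs (x # y # xs) = add_mset (x, y) (path_arcs (y # xs))"

lemma path_arcs_Cons: "xs \<noteq> [] \<Longrightarrow> path_arcs (x # xs) = add_mset (x, hd xs) (path_arcs xs)"
  by (cases xs) auto

text \<open>The left part keeps \<open>hd ys\<close> as its exit, so a block always appears together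
  with its successor vertex, as in the invariants for the strip.\<close>

lemma path_arcs_append:
  "ys \<noteq> [] \<Longrightarrow> path_arcs (xs @ ys) = path_arcs (xs @ [hd ys]) + path_arcs ys"
proof (induction xs)
  case Nil
  then show ?case by (cases ys) auto
next
  case (Cons x xs)
  then show ?case by (cases xs) (auto simp: path_arcs_Cons)
qed

text \<open>This rule and the next two cut lists mixing explicit vertices and named paths into
  single arcs and blocks with their exits.\<close>

lemma path_arcs_append_Cons [simp]:
  "path_arcs (xs @ x # y # ys) = path_arcs (xs @ [x]) + path_arcs (x # y # ys)"
  using path_arcs_append[of "x # y # ys" xs] by simp

lemma path_arcs_Cons_append [simp]:
  "ys \<noteq> [] \<Longrightarrow> path_arcs (x # ys @ zs) = add_mset (x, hd ys) (path_arcs (ys @ zs))"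
  using path_arcs_Cons[of "ys @ zs" x] by simp

lemma path_arcs_append_Cons_append [simp]:
  "ys \<noteq> [] \<Longrightarrow>
    path_arcs (xs @ x # ys @ zs) = path_arcs (xs @ [x]) + add_mset (x, hd ys) (path_arcs (ys @ zs))"
  using path_arcs_append[of "x # ys @ zs" xs] by simp

fun cols :: "nat \<Rightarrow> vert multiset" where
  "cols 0 = {#}"
| "cols (Suc i) = {#A0 i, A1 i, B0 i, B1 i#} + cols i"

text \<open>The arcs inside the columns, along \<open>H\<^sub>0\<close> and along the reverse of \<open>H\<^sub>1\<close>, grouped by their
  tails. The last pair of columns and infinity, where both cycles turn, are treated in
  \<open>strip_arcs\<close>.\<close>

fun col_arcs :: "nat \<Rightarrow> (vert \<times> vert) multiset" where
  "col_arcs 0 =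
     {#(A0 0, A1 0), (A0 0, B0 1), (A0 0, B1 1), (A0 0, I0), (A0 0, I1),
       (A1 0, A0 0), (A1 0, B0 1), (A1 0, B1 1), (A1 0, I0), (A1 0, I1),
       (B0 0, B1 0), (B0 0, A0 0), (B0 0, A1 0), (B0 0, A0 1), (B0 0, A1 1),
       (B1 0, B0 0), (B1 0, A0 0), (B1 0, A1 0), (B1 0, A0 1), (B1 0, A1 1)#}"
| "col_arcs (Suc 0) =
     {#(A0 1, A1 1), (A0 1, B0 2), (A0 1, B1 2), (A0 1, A0 0), (A0 1, A1 0),
       (A1 1, A0 1), (A1 1, B0 2), (A1 1, B1 2), (A1 1, A0 0), (A1 1, A1 0),
       (B0 1, B1 1), (B0 1, A0 1), (B0 1, A1 1), (B0 1, A0 2), (B0 1, A1 2),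
       (B1 1, B0 1), (B1 1, A0 1), (B1 1, A1 1), (B1 1, A0 2), (B1 1, A1 2)#}"
| "col_arcs (Suc (Suc h)) =
     (let i = Suc (Suc h); j = Suc i in
     {#(A0 i, A1 i), (A0 i, B0 j), (A0 i, B1 j), (A0 i, B0 h), (A0 i, B1 h),
       (A1 i, A0 i), (A1 i, B0 j), (A1 i, B1 j), (A1 i, B0 h), (A1 i, B1 h),
       (B0 i, B1 i), (B0 i, A0 i), (B0 i, A1 i), (B0 i, A0 j), (B0 i, A1 j),
       (B1 i, B0 i), (B1 i, A0 i), (B1 i, A1 i), (B1 i, A0 j), (B1 i, A1 j)#})"

fun out_arcs :: "nat \<Rightarrow> (vert \<times> vert) multiset" where
  "out_arcs 0 = {#}"
| "out_arcs (Suc i) = col_arcs i + out_arcs i"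

text \<open>Every vertex has five successors: its column mate, two along \<open>H\<^sub>0\<close>
  and two along the reverse of \<open>H\<^sub>1\<close>. At the right end \<open>H\<^sub>0\<close>
  runs from the last \<open>A\<close> to infinity, the reverse of \<open>H\<^sub>1\<close> from
  infinity to the last \<open>B\<close> and on to the \<open>B\<close> before it. Fewer than three
  pairs get the empty multiset by default.\<close>

fun strip_arcs :: "nat \<Rightarrow> (vert \<times> vert) multiset" where
  "strip_arcs (Suc (Suc (Suc g))) =
     (let h = Suc g; i = Suc h in
     {#(A0 i, A1 i), (A0 i, B0 g), (A0 i, B1 g), (A0 i, I0), (A0 i, I1),
       (A1 i, A0 i), (A1 i, B0 g), (A1 i, B1 g), (A1 i, I0), (A1 i, I1),
       (B0 i, B1 i), (B0 i, A0 i), (B0 i, A1 i), (B0 i, B0 h), (B0 i, B1 h),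
       (B1 i, B0 i), (B1 i, A0 i), (B1 i, A1 i), (B1 i, B0 h), (B1 i, B1 h),
       (I0, I1), (I0, B0 0), (I0, B1 0), (I0, B0 i), (I0, B1 i),
       (I1, I0), (I1, B0 0), (I1, B1 0), (I1, B0 i), (I1, B1 i)#} + out_arcs i)"
| "strip_arcs _ = {#}"

definition strip :: "nat \<Rightarrow> vert multiset" where
  "strip k = {#I0, I1#} + cols k"

lemma mset_zip_rotate1:
  "xs \<noteq> [] \<Longrightarrow> mset (zip xs (rotate1 xs)) = path_arcs (xs @ [hd xs])"
proof -
  have *: "mset (zip (x # xs) (xs @ [y])) = path_arcs (x # xs @ [y])" for x y :: 'a and xs
    by (induction xs arbitrary: x) auto
  show "xs \<noteq> [] \<Longrightarrow> ?thesis"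
    using * by (cases xs) auto
qed

section \<open>Absence of repetitions in the strip\<close>

definition simple_mset :: "'a multiset \<Rightarrow> bool" where
  "simple_mset M \<longleftrightarrow> (\<forall>x. count M x \<le> 1)"

lemma simple_mset_empty [simp]: "simple_mset {#}"
  by (simp add: simple_mset_def)

lemma simple_mset_union:
  "simple_mset (M + N) \<longleftrightarrow> simple_mset M \<and> simple_mset N \<and> set_mset M \<inter> set_mset N = {}"
proof -
  have "count M x + count N x \<le> 1 \<longleftrightarrow> count M x \<le> 1 \<and> count N x \<le> 1 \<and> \<not> (x \<in># M \<and> x \<in># N)" for x
    by (auto simp flip: count_greater_zero_iff)
  then show ?thesis by (auto simp: simple_mset_def)
qed

lemma simple_mset_add_mset [simp]:
  "simple_mset (add_mset x M) \<longleftrightarrow> x \<notin># M \<and> simple_mset M"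
  using simple_mset_union[of "{#x#}" M] by (auto simp: simple_mset_def)

lemma simple_mset_mset: "simple_mset (mset xs) \<longleftrightarrow> distinct xs"
  by (induction xs) auto

lemma set_cols: "set_mset (cols n) = (\<Union>i<n. {A0 i, A1 i, B0 i, B1 i})"
  by (induction n) (auto simp: lessThan_Suc)

lemma simple_mset_strip: "simple_mset (strip k)"
proof -
  have "simple_mset (cols n)" for n
    by (induction n) (auto simp: set_cols)
  then show ?thesis by (auto simp: strip_def set_cols)
qed

lemma col_arcs_tail: "(u, v) \<in># col_arcs i \<Longrightarrow> u \<in> {A0 i, A1 i, B0 i, B1 i}"
  by (cases i rule: col_arcs.cases) (auto simp: Let_def)

lemma out_arcs_tail: "(u, v) \<in># out_arcs n \<Longrightarrow> u \<in># cols n"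
  by (induction n) (auto dest: col_arcs_tail)

text \<open>Arcs of different pairs of columns have different tails, so only repetitions within one
  pair must be excluded.\<close>

lemma simple_mset_out_arcs: "simple_mset (out_arcs n)"
proof (induction n)
  case (Suc i)
  have "simple_mset (col_arcs i)"
    by (cases i rule: col_arcs.cases) (auto simp: Let_def)
  moreover have "set_mset (col_arcs i) \<inter> set_mset (out_arcs i) = {}"
    by (fastforce dest!: col_arcs_tail out_arcs_tail simp: set_cols)
  ultimately show ?case
    using Suc by (simp add: simple_mset_union)
qed simp

lemma notin_out_arcs:
  "(A0 n, v) \<notin># out_arcs n" "(A1 n, v) \<notin># out_arcs n" "(B0 n, v) \<notin># out_arcs n"
  "(B1 n, v) \<notin># out_arcs n" "(I0, v) \<notin># out_arcs n" "(I1, v) \<notin># out_arcs n"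
  by (auto dest!: out_arcs_tail simp: set_cols)

lemma simple_mset_strip_arcs: "simple_mset (strip_arcs k)"
  by (cases k rule: strip_arcs.cases) (simp_all add: Let_def notin_out_arcs simple_mset_out_arcs
    del: out_arcs.simps)

section \<open>Embedding the strip into the blow-up\<close>

text \<open>\<open>B\<close> and \<open>A\<close> of pair \<open>i\<close> stand at positions 2i and
  2i+1 of \<open>H\<^sub>0\<close>, which therefore traverses the strip from left to right.\<close>

fun place :: "nat \<Rightarrow> vert \<Rightarrow> nat \<times> bool" where
  "place r (A0 i) = (zigzag r 0 (2 * i + 1), False)"
| "place r (A1 i) = (zigzag r 0 (2 * i + 1), True)"
| "place r (B0 i) = (zigzag r 0 (2 * i), False)"
| "place r (B1 i) = (zigzag r 0 (2 * i), True)"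
| "place r I0 = (2 * r, False)"
| "place r I1 = (2 * r, True)"

lemma place_bij:
  assumes "r > 0"
  shows "inj_on (place r) (set_mset (strip r))"
    and "place r ` set_mset (strip r) = {..2 * r} \<times> UNIV"
proof -
  have eq: "zigzag r 0 i = zigzag r 0 j \<longleftrightarrow> i = j" if "i < 2 * r" "j < 2 * r" for i j
    using that inj_on_eq_iff[OF inj_on_zigzag[of r 0]] by simp
  have less: "zigzag r 0 i \<noteq> 2 * r" "2 * r \<noteq> zigzag r 0 i" "zigzag r 0 i \<le> 2 * r" for i
    using zigzag_less[OF assms, of 0 i] by auto
  have parity: "2 * i \<noteq> Suc (2 * j)" "Suc (2 * j) \<noteq> 2 * i" for i j :: nat
    by presburger+
  show "inj_on (place r) (set_mset (strip r))"
    by (rule inj_onI) (auto simp: strip_def set_cols eq less parity)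
  have "{..<2 * r} = zigzag r 0 ` {..<2 * r}"
    using inj_on_zigzag[of r 0] zigzag_less[OF assms, of 0]
    by (intro endo_inj_surj[symmetric]) auto
  then have surj: "\<exists>i<2 * r. x = zigzag r 0 i" if "x < 2 * r" for x
    using that by (metis imageE lessThan_iff)
  have "(x, a) \<in> place r ` set_mset (strip r)" if x: "x \<le> 2 * r" for x a
  proof (cases "x = 2 * r")
    case True
    have "(x, a) = place r (if a then I1 else I0)" using True by simp
    then show ?thesis by (auto simp: strip_def)
  next
    case False
    then obtain i where i: "i < 2 * r" "x = zigzag r 0 i" using surj[of x] x by auto
    define h where "h = i div 2"
    have "h < r" "i = 2 * h \<or> i = 2 * h + 1"
      using i(1) unfolding h_def by (linarith, presburger)
    then have "(x, a) = place r (if i = 2 * h then if a then B1 h else B0 h else if a then A1 h else A0 h)"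
      using i(2) by auto
    moreover have "(if i = 2 * h then if a then B1 h else B0 h else if a then A1 h else A0 h) \<in># strip r"
      using \<open>h < r\<close> by (auto simp: strip_def set_cols)
    ultimately show ?thesis by (rule image_eqI)
  qed
  then have "{..2 * r} \<times> UNIV \<subseteq> place r ` set_mset (strip r)"
    by auto
  moreover have "place r ` set_mset (strip r) \<subseteq> {..2 * r} \<times> UNIV"
    using less(3) by (auto simp: strip_def set_cols)
  ultimately show "place r ` set_mset (strip r) = {..2 * r} \<times> UNIV"
    by (rule antisym[rotated])
qed

lemma place_arcs:
  assumes "(u, v) \<in># strip_arcs r"
  shows "fst (place r u) = fst (place r v) \<or>
    (fst (place r u), fst (place r v)) \<in> cycle_arcs (walecki r 0) \<or>
    (fst (place r v), fst (place r u)) \<in> cycle_arcs (walecki r 1)"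
proof (cases r rule: strip_arcs.cases)
  case (1 g)
  have r: "r > 0" using 1 by simp
  define a b where "a i = zigzag r 0 (Suc (2 * i))" and "b i = zigzag r 0 (2 * i)" for i
  \<comment> \<open>In these names \<open>H\<^sub>1\<close>, the shift of \<open>H\<^sub>0\<close>
    by one, reads a0, a1, b0, a2, b1, ..., a(r-1), b(r-2), b(r-1), infinity. Apart from infinity it
    only joins pairs at distance at most two.\<close>
  note W = cycle_arcs_walecki[OF r]
  have z0: "zigzag r 1 0 = a 0"
    using mod_add_self2[of 1 "2 * r"] by (simp add: zigzag_def a_def)
  have z1: "\<And>i. zigzag r 1 (Suc (2 * i)) = a (Suc i)"
      "\<And>i. i < r \<Longrightarrow> zigzag r 1 (Suc (Suc (2 * i))) = b i"
      "zigzag r 1 (2 * r - 1) = b (Suc (Suc g))"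
    using 1 by (simp_all add: zigzag_def a_def b_def)
  have W0: "(b i, a i) \<in> cycle_arcs (walecki r 0)" if "i < r" for i
    using that unfolding W by (auto simp: a_def b_def)
  have W0': "(a i, b (Suc i)) \<in> cycle_arcs (walecki r 0)" if "Suc i < r" for i
    using that unfolding W by (auto simp: a_def b_def intro!: exI[of _ "Suc (2 * i)"])
  have W0'': "(a (Suc (Suc g)), 2 * r) \<in> cycle_arcs (walecki r 0)" "(2 * r, b 0) \<in> cycle_arcs (walecki r 0)"
    using 1 unfolding W by (auto simp: a_def b_def)
  have W1: "(a 0, a 1) \<in> cycle_arcs (walecki r 1)" "(2 * r, a 0) \<in> cycle_arcs (walecki r 1)"
    "(b (Suc (Suc g)), 2 * r) \<in> cycle_arcs (walecki r 1)"
    using 1 z0 z1(1)[of 0] z1(3) unfolding W by (auto intro!: exI[of _ 0])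
  have W1': "(b i, a (Suc (Suc i))) \<in> cycle_arcs (walecki r 1)" if "Suc (Suc i) < r" for i
    using that z1(1)[of "Suc i"] z1(2)[of i] unfolding W
    by (auto intro!: exI[of _ "Suc (Suc (2 * i))"])
  have W1'': "(a (Suc i), b i) \<in> cycle_arcs (walecki r 1)" if "Suc i < r" for i
    using that z1(1)[of i] z1(2)[of i] unfolding W
    by (auto intro!: exI[of _ "Suc (2 * i)"])
  have W1''': "(b (Suc g), b (Suc (Suc g))) \<in> cycle_arcs (walecki r 1)"
    using 1 z1(2)[of "Suc g"] z1(3) unfolding W
    by (auto intro!: exI[of _ "Suc (Suc (2 * Suc g))"])
  define P where "P u v \<longleftrightarrow> fst (place r u) = fst (place r v) \<or>
    (fst (place r u), fst (place r v)) \<in> cycle_arcs (walecki r 0) \<or>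
    (fst (place r v), fst (place r u)) \<in> cycle_arcs (walecki r 1)" for u v
  have col: "P u v" if "(u, v) \<in># col_arcs i" "Suc i < r" for u v i
    using that W0[of i] W0'[of i] W1'[of "i - 2"] W1(1,2) W1''[of i] W1''[of 0]
    by (cases i rule: col_arcs.cases) (auto simp: P_def Let_def a_def b_def)
  have out: "P u v" if "(u, v) \<in># out_arcs n" "n < r" for u v n
    using that by (induction n) (auto intro: col)
  \<comment> \<open>Only tails in the last pair or at infinity remain to be checked here.\<close>
  have "(u, v) \<in># out_arcs (Suc (Suc g)) \<or> P u v"
    using assms W0[of "Suc (Suc g)"] W0'' W1 W1'[of g] W1''' 1
    by (auto simp: P_def Let_def a_def b_def)
  then show ?thesis using out[of u v "Suc (Suc g)"] 1 unfolding P_def by auto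
qed (use assms in auto)

section \<open>Five factors of the strip\<close>

text \<open>Distinct vertices and disjoint arcs are implicit: \<open>strip\<close> and
  \<open>strip_arcs\<close> have no repeated elements.\<close>

definition strip_factors :: "nat \<Rightarrow> (vert list \<times> vert list) list \<Rightarrow> bool" where
  "strip_factors k fs \<longleftrightarrow> length fs = 5 \<and>
     (\<forall>(c, d)\<in>set fs. length c = 2 * k + 1 \<and> length d = 2 * k + 1 \<and> mset (c @ d) = strip k) \<and>
     sum_list (map (\<lambda>(c, d). path_arcs (c @ [hd c]) + path_arcs (d @ [hd d])) fs) = strip_arcs k"

text \<open>The letters \<open>a\<close> to \<open>e\<close> stand for the five factors. Restricted to the first \<^term>\<open>p + 2\<close>
  pairs of columns, the cycles of a factor fall apart into paths whose first vertices, and whose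
  successors on the remaining strip, depend on \<open>p\<close> by translation at most. Hence the paths with parameter
  \<^term>\<open>p + 2\<close> arise by joining those for \<open>p\<close> with a fixed pattern on the two new pairs.\<close>

definition left_paths_even where
  "left_paths_even p a1 a2 a3 b1 b2 c1 c2 c3 d1 d2 e1 e2 \<longleftrightarrow>
     (let q = Suc p; r = Suc q in
     list_all2 (\<lambda>xs x. xs \<noteq> [] \<and> hd xs = x)
        [a1, a2, a3, b1, b2, c1, c2, c3, d1, d2, e1, e2]
        [B1 0, B1 q, B0 p, B0 p, B1 q, B0 q, B1 p, B0 0, B0 q, B1 p, B1 0, B0 0] \<and>
     (\<forall>M \<in> set [mset a1 + mset a2 + mset a3, mset b1 + mset b2, mset c1 + mset c2 + mset c3, mset d1
       + mset d2, mset e1 + mset e2]. M = cols r) \<and>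
     [length a1 + length a2, length a3, length b1, length b2, length c1 + length c2, length c3,
       length d1, length d2, length e1, length e2] =
        [2 * p + 7, 2 * p + 1, 2 * p + 2, 2 * p + 6, 2 * p + 6, 2 * p + 2, 2 * p + 8, 2 * p, 2 * p +
          5, 2 * p + 3] \<and>
     path_arcs (a1 @ [B1 r]) +
        path_arcs (a2 @ [I0]) +
        path_arcs (a3 @ [A1 r]) +
        path_arcs (b1 @ [I1]) +
        path_arcs (b2 @ [I0]) +
        path_arcs (c1 @ [A0 r]) +
        path_arcs (c2 @ [I1]) +
        path_arcs (c3 @ [B0 r]) +
        path_arcs (d1 @ [A0 r]) +
        path_arcs (d2 @ [B0 r]) +
        path_arcs (e1 @ [A1 r]) +
        path_arcs (e2 @ [B1 r]) = out_arcs r)"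

text \<open>The starting paths fill three pairs of columns; steps of two keep \<open>p\<close>
  odd.\<close>

lemma left_paths_even_base:
  "left_paths_even 1
     [B1 0, A1 1, A1 0, B1 1, A0 2]
     [B1 2, A1 2, B0 0, A0 0]
     [B0 1, A0 1, B0 2]
     [B0 1, B1 1, A1 1, A0 0]
     [B1 2, B0 2, A1 2, A0 2, B1 0, B0 0, A0 1, A1 0]
     [B0 2]
     [B1 1, B0 1, A1 2, B1 0, A0 1, A0 0, A1 0]
     [B0 0, A1 1, B1 2, A0 2]
     [B0 2, A0 2, B0 0, B1 0, A1 0, A0 0, B0 1, A1 1, A0 1, B1 2]
     [B1 1, A1 2]
     [B1 0, A0 0, B1 1, A0 1, A1 1, B0 2, B1 2]
     [B0 0, A1 0, B0 1, A0 2, A1 2]"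
  by (simp add: left_paths_even_def Let_def eval_nat_numeral add_mset_commute)

text \<open>Paths entered at pair 0 grow at the end, paths leaving for infinity at the front, others
  on both sides; \<open>c1\<close> and \<open>c2\<close> are joined and a new \<open>c1\<close>
  starts. Each recorded length grows by 4. Only total lengths are recorded for paths that end up on
  one cycle.\<close>

lemma left_paths_even_step:
  assumes "left_paths_even p a1 a2 a3 b1 b2 c1 c2 c3 d1 d2 e1 e2" and idx: "q = Suc p" "r = Suc q"
    "s = Suc r"
  shows "left_paths_even r
     (a1 @ [B1 r, A0 s])
     ([B1 s, A1 s] @ a2)
     ([B0 r, A0 r] @ a3 @ [A1 r, B0 s])
     ([B0 r, B1 r, A0 r, A1 r] @ b1)
     ([B1 s, B0 s, A1 s, A0 s] @ b2)
     ([B0 s])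
     ([B1 r, A1 s] @ c1 @ [A0 r] @ c2)
     (c3 @ [B0 r, A1 r, B1 s, A0 s])
     ([B0 s, A0 s] @ d1 @ [A0 r, B1 s])
     ([B1 r, A1 r] @ d2 @ [B0 r, A1 s])
     (e1 @ [A1 r, A0 r, B0 s, B1 s])
     (e2 @ [B1 r, B0 r, A0 s, A1 s])"
  \<comment> \<open>Reversing the arc equation lets it replace \<open>out_arcs\<close> of the old
    pairs by the old path arcs, so that both sides agree up to order.\<close>
  using assms(1) unfolding left_paths_even_def Let_def idx
  by (auto simp: add_ac add_mset_commute dest!: sym[of _ "out_arcs _"])

lemma left_paths_even_exists: "\<exists>a1 a2 a3 b1 b2 c1 c2 c3 d1 d2 e1 e2. left_paths_even (2 * t + 1) a1
  a2 a3 b1 b2 c1 c2 c3 d1 d2 e1 e2"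
proof (induction t)
  case 0
  have eq: "2 * 0 + 1 = (1 :: nat)" by simp
  show ?case unfolding eq by (intro exI) (rule left_paths_even_base)
next
  case (Suc t)
  have eq: "2 * Suc t + 1 = Suc (Suc (2 * t + 1))" by simp
  from Suc show ?case
  proof (elim exE)
    fix a1 a2 a3 b1 b2 c1 c2 c3 d1 d2 e1 e2 assume "left_paths_even (2 * t + 1) a1 a2 a3 b1 b2 c1 c2
      c3 d1 d2 e1 e2"
    from left_paths_even_step[OF this refl refl refl] show ?thesis
      unfolding eq by (intro exI)
  qed
qed

text \<open>The pairs r, s, t and infinity close the paths of each factor into two cycles. There are
  p + 5 pairs in all, an even number for odd \<open>p\<close>.\<close>

lemma strip_factors_even:
  assumes "left_paths_even p a1 a2 a3 b1 b2 c1 c2 c3 d1 d2 e1 e2" and idx: "q = Suc p" "r = Suc q"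
    "s = Suc r" "t = Suc s"
  shows "strip_factors (Suc t)
     [(a1 @ [B1 r, A1 s] @ a2 @ [I0, I1],
       a3 @ [A1 r, B0 s, B1 s, A0 s, B0 t, B1 t, A1 t, A0 t, B0 r, A0 r]),
      (b1 @ [I1, B1 t, B0 s, A0 t, A1 t, B0 r, B1 r, A0 r, A1 r],
       b2 @ [I0, B0 t, B1 s, A1 s, A0 s]),
      (c1 @ [A0 r] @ c2 @ [I1, B0 t, B0 s, A1 s],
       c3 @ [B0 r, A1 r, B1 s, A1 t, B1 r, A0 s, B1 t, A0 t, I0]),
      (d1 @ [A0 r, B0 s, A0 s],
       d2 @ [B0 r, A1 s, B0 t, A1 t, I1, I0, B1 t, B1 s, A0 t, B1 r, A1 r]),
      (e1 @ [A1 r, A0 r, B1 s, B0 s, A1 t, I0],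
       e2 @ [B1 r, B0 r, A0 s, A1 s, B1 t, B0 t, A0 t, I1])]"
  using assms(1) unfolding left_paths_even_def Let_def idx
  by (auto simp: strip_factors_def strip_def add_ac add_mset_commute dest!: sym[of _ "out_arcs _"])

text \<open>The counterpart for an odd total number of pairs. Even and odd refer to that total;
  \<open>p\<close> is odd in both families.\<close>

definition left_paths_odd where
  "left_paths_odd p a1 a2 a3 b1 b2 c1 c2 c3 d1 d2 e1 e2 \<longleftrightarrow>
     (let q = Suc p; r = Suc q in
     list_all2 (\<lambda>xs x. xs \<noteq> [] \<and> hd xs = x)
        [a1, a2, a3, b1, b2, c1, c2, c3, d1, d2, e1, e2]
        [B1 0, B0 q, B0 p, B1 q, B1 p, B0 0, B0 q, B0 p, B1 p, B1 q, B1 0, B0 0] \<and>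
     (\<forall>M \<in> set [mset a1 + mset a2 + mset a3, mset b1 + mset b2, mset c1 + mset c2 + mset c3, mset d1
       + mset d2, mset e1 + mset e2]. M = cols r) \<and>
     [length a1, length a2 + length a3, length b1, length b2, length c1 + length c2, length c3,
       length d1, length d2, length e1, length e2] =
        [2 * p + 6, 2 * p + 2, 2 * p + 4, 2 * p + 4, 2 * p + 8, 2 * p, 2 * p + 8, 2 * p, 2 * p + 5,
          2 * p + 3] \<and>
     path_arcs (a1 @ [B1 r]) +
        path_arcs (a2 @ [A0 r]) +
        path_arcs (a3 @ [I0]) +
        path_arcs (b1 @ [I0]) +
        path_arcs (b2 @ [I1]) +
        path_arcs (c1 @ [A0 r]) +
        path_arcs (c2 @ [I1]) +
        path_arcs (c3 @ [B1 r]) +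
        path_arcs (d1 @ [A1 r]) +
        path_arcs (d2 @ [B0 r]) +
        path_arcs (e1 @ [B0 r]) +
        path_arcs (e2 @ [A1 r]) = out_arcs r)"

lemma left_paths_odd_base:
  "left_paths_odd 1
     [B1 0, B0 0, A0 0, B1 1, A1 1, B1 2, A0 2, A1 2]
     [B0 2]
     [B0 1, A0 1, A1 0]
     [B1 2, B0 2, A0 2, B1 0, A0 1, A0 0]
     [B1 1, B0 1, A1 2, B0 0, A1 1, A1 0]
     [B0 0, A1 0, B1 1, A0 1, B1 2]
     [B0 2, A1 2, B1 0, A1 1, A0 0]
     [B0 1, A0 2]
     [B1 1, A0 2, B0 0, B1 0, A0 0, A1 0, B0 1, A1 1, A0 1, B0 2]
     [B1 2, A1 2]
     [B1 0, A1 0, A0 0, B0 1, B1 1, A1 2, A0 2]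
     [B0 0, A0 1, A1 1, B0 2, B1 2]"
  by (simp add: left_paths_odd_def Let_def eval_nat_numeral add_mset_commute)

text \<open>Here \<open>a2\<close> and \<open>a3\<close> are the paths that get joined, with a new
  \<open>a2\<close> starting.\<close>

lemma left_paths_odd_step:
  assumes "left_paths_odd p a1 a2 a3 b1 b2 c1 c2 c3 d1 d2 e1 e2" and idx: "q = Suc p" "r = Suc q" "s
    = Suc r"
  shows "left_paths_odd r
     (a1 @ [B1 r, A1 r, B1 s, A1 s])
     ([B0 s])
     ([B0 r, A0 s] @ a2 @ [A0 r] @ a3)
     ([B1 s, B0 s, A0 s, A1 s] @ b1)
     ([B1 r, B0 r, A0 r, A1 r] @ b2)
     (c1 @ [A0 r, B1 s])
     ([B0 s, A1 s] @ c2)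
     ([B0 r, A1 r] @ c3 @ [B1 r, A0 s])
     ([B1 r, A0 r] @ d1 @ [A1 r, B0 s])
     ([B1 s, A0 s] @ d2 @ [B0 r, A1 s])
     (e1 @ [B0 r, B1 r, A1 s, A0 s])
     (e2 @ [A1 r, A0 r, B0 s, B1 s])"
  using assms(1) unfolding left_paths_odd_def Let_def idx
  by (auto simp: add_ac add_mset_commute dest!: sym[of _ "out_arcs _"])

lemma left_paths_odd_exists: "\<exists>a1 a2 a3 b1 b2 c1 c2 c3 d1 d2 e1 e2. left_paths_odd (2 * t + 1) a1 a2
  a3 b1 b2 c1 c2 c3 d1 d2 e1 e2"
proof (induction t)
  case 0
  have eq: "2 * 0 + 1 = (1 :: nat)" by simp
  show ?case unfolding eq by (intro exI) (rule left_paths_odd_base)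
next
  case (Suc t)
  have eq: "2 * Suc t + 1 = Suc (Suc (2 * t + 1))" by simp
  from Suc show ?case
  proof (elim exE)
    fix a1 a2 a3 b1 b2 c1 c2 c3 d1 d2 e1 e2 assume "left_paths_odd (2 * t + 1) a1 a2 a3 b1 b2 c1 c2
      c3 d1 d2 e1 e2"
    from left_paths_odd_step[OF this refl refl refl] show ?thesis
      unfolding eq by (intro exI)
  qed
qed

text \<open>The closing pattern spans one pair more, giving p + 6 pairs in all.\<close>

lemma strip_factors_odd:
  assumes "left_paths_odd p a1 a2 a3 b1 b2 c1 c2 c3 d1 d2 e1 e2" and idx: "q = Suc p" "r = Suc q" "s
    = Suc r" "t = Suc s" "u = Suc t"
  shows "strip_factors (Suc u)
     [(a1 @ [B1 r, A1 r, B0 s, A0 t, B0 u, A1 u, I1],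
       a2 @ [A0 r] @ a3 @ [I0, B1 u, A0 u, B1 s, A1 s, B0 t, B1 t, A1 t, B0 r, A0 s]),
      (b1 @ [I0, B0 u, B1 t, A1 u, A0 u, B0 s, B1 s, A0 s, A1 s],
       b2 @ [I1, B1 u, B0 t, A0 t, A1 t, B1 r, B0 r, A0 r, A1 r]),
      (c1 @ [A0 r, B0 s, A1 s] @ c2 @ [I1, I0],
       c3 @ [B1 r, A0 s, B0 t, A0 u, A1 u, B1 s, A1 t, B0 u, B1 u, B1 t, A0 t, B0 r, A1 r]),
      (d1 @ [A1 r, B1 s, A0 t, B1 r, A0 r],
       d2 @ [B0 r, A1 s, B1 t, A0 u, I0, I1, B0 u, B0 t, A1 t, B1 u, A1 u, B0 s, A0 s]),
      (e1 @ [B0 r, B1 r, A1 s, A0 s, B1 t, B0 t, A1 u, I0],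
       e2 @ [A1 r, A0 r, B1 s, B0 s, A1 t, A0 t, B1 u, B0 u, A0 u, I1])]"
  using assms(1) unfolding left_paths_odd_def Let_def idx
  by (auto simp: strip_factors_def strip_def add_ac add_mset_commute dest!: sym[of _ "out_arcs _"])

text \<open>The two families begin at 6 and 7 pairs, so 5 is supplied explicitly.\<close>

lemma strip_factors_5:
  "strip_factors 5
     [([A0 0, A1 0, B0 1, A1 1, B0 2, A1 3, B1 1, A0 2, B0 0, B1 0, A0 1],
       [A1 2, B1 3, B0 3, A0 3, B1 4, A0 4, I0, I1, B0 4, A1 4, B1 2]),
      ([A0 0, B0 1, B1 1, A1 2, B1 0, A1 1, A0 1, A1 0, I1, I0, B0 0],
       [A0 2, B1 3, A0 3, B0 4, B0 3, A1 3, B1 4, A1 4, A0 4, B1 2, B0 2]),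
      ([A0 0, B1 1, A0 1, B0 2, B1 2, A0 3, A1 3, B0 1, A1 2, A0 2, B1 0],
       [A1 0, I0, B0 4, B1 4, B0 3, B1 3, A0 4, A1 4, I1, B0 0, A1 1]),
      ([A0 0, I0, B1 4, B1 3, A1 3, B0 4, A0 4, I1, B1 0, B0 0, A1 0],
       [A0 1, A1 1, B1 2, A0 2, A1 2, B0 3, A1 4, B0 2, A0 3, B1 1, B0 1]),
      ([A0 0, I1, B1 4, B0 4, B1 3, A1 4, I0, B1 0, A1 0, B1 1, A1 1],
       [B0 0, A0 1, B1 2, A1 3, A0 3, B0 1, A0 2, B0 3, A0 4, B0 2, A1 2])]"
  by (simp add: strip_factors_def strip_def eval_nat_numeral add_mset_commute)

lemma ex_strip_factors:
  assumes "r \<ge> 5"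
  shows "\<exists>fs. strip_factors r fs"
proof -
  consider "r = 5" | t where "r = 2 * t + 6" | t where "r = 2 * t + 7"
  proof -
    have "r = 5 \<or> r = 2 * ((r - 6) div 2) + 6 \<or> r = 2 * ((r - 7) div 2) + 7"
      using assms by presburger
    then show thesis using that by blast
  qed
  then show ?thesis
  proof cases
    case 1
    then show ?thesis using strip_factors_5 by blast
  next
    case 2
    from left_paths_even_exists[of t] show ?thesis
    proof (elim exE)
      fix a1 a2 a3 b1 b2 c1 c2 c3 d1 d2 e1 e2 assume "left_paths_even (2 * t + 1) a1 a2 a3 b1 b2 c1
        c2 c3 d1 d2 e1 e2"
      from strip_factors_even[OF this refl refl refl refl] show ?thesis
        using 2 by (auto simp: eval_nat_numeral)
    qed
  next
    case 3
    from left_paths_odd_exists[of t] show ?thesis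
    proof (elim exE)
      fix a1 a2 a3 b1 b2 c1 c2 c3 d1 d2 e1 e2 assume "left_paths_odd (2 * t + 1) a1 a2 a3 b1 b2 c1
        c2 c3 d1 d2 e1 e2"
      from strip_factors_odd[OF this refl refl refl refl refl] show ?thesis
        using 3 by (auto simp: eval_nat_numeral)
    qed
  qed
qed

text \<open>The concatenated arc lists form the repetition-free multiset
  \<open>strip_arcs r\<close>, hence are distinct; \<open>place\<close> then transports the
  packing.\<close>

lemma packing_strip_factors:
  assumes "strip_factors r fs" "r > 0"
  shows "packing (2 * r + 1) ({..2 * r} \<times> UNIV)
    {((u, a), (v, b)). u = v \<or> (u, v) \<in> cycle_arcs (walecki r 0) \<or> (v, u) \<in> cycle_arcs (walecki r 1)}
    (map (map_prod (map (place r)) (map (place r))) fs)"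
proof -
  have fs: "length c = 2 * r + 1" "length d = 2 * r + 1" "mset (c @ d) = strip r"
    if "(c, d) \<in> set fs" for c d
    using assms(1) that by (auto simp: strip_factors_def)
  have "mset (arc_list p) = (\<lambda>(c, d). path_arcs (c @ [hd c]) + path_arcs (d @ [hd d])) p"
    if "p \<in> set fs" for p
  proof -
    obtain c d where p: "p = (c, d)" by (cases p)
    have "c \<noteq> []" "d \<noteq> []" using fs[of c d] that p by auto
    then show ?thesis by (simp add: p arc_list_def mset_zip_rotate1)
  qed
  then have "mset (concat (map arc_list fs)) =
      sum_list (map (\<lambda>(c, d). path_arcs (c @ [hd c]) + path_arcs (d @ [hd d])) fs)"
    by (induction fs) auto
  then have arcs: "mset (concat (map arc_list fs)) = strip_arcs r"
    using assms(1) by (simp add: strip_factors_def)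
  have "packing (2 * r + 1) (set_mset (strip r)) (set_mset (strip_arcs r)) fs"
  proof (rule packing_arc_listI)
    show "distinct (concat (map arc_list fs))"
      using simple_mset_strip_arcs[of r] simple_mset_mset arcs by metis
    show "set (concat (map arc_list fs)) \<subseteq> set_mset (strip_arcs r)"
      using arcs by (metis set_mset_mset subset_refl)
    show "length c = 2 * r + 1 \<and> length d = 2 * r + 1 \<and> distinct (c @ d) \<and> set (c @ d) = set_mset (strip r)"
      if "(c, d) \<in> set fs" for c d
      using fs[OF that] simple_mset_strip[of r] simple_mset_mset set_mset_mset by metis
  qed
  then have "packing (2 * r + 1) (place r ` set_mset (strip r))
      (map_prod (place r) (place r) ` set_mset (strip_arcs r))
      (map (map_prod (map (place r)) (map (place r))) fs)"
    using place_bij(1)[OF assms(2)] by (rule packing_map)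
  then show ?thesis
    unfolding place_bij(2)[OF assms(2)]
  proof (rule packing_mono, intro subsetI)
    fix p assume "p \<in> map_prod (place r) (place r) ` set_mset (strip_arcs r)"
    then obtain u v where "p = (place r u, place r v)" "(u, v) \<in># strip_arcs r" by auto
    then show "p \<in> {((u, a), (v, b)). u = v \<or> (u, v) \<in> cycle_arcs (walecki r 0) \<or>
        (v, u) \<in> cycle_arcs (walecki r 1)}"
      using place_arcs[of u v r] by (simp add: split_beta)
  qed
qed

section \<open>Three-colouring the first two cycles\<close>

text \<open>Finite edges of \<open>H\<^sub>0\<close> and \<open>H\<^sub>1\<close> have sum 0 to 3
  modulo 2r, so for r \<ge> 5 they run between 1..r and the other residues, except {1, 2} and {r+1,
  r+2}. Recolouring 2 and r+2 repairs these two.\<close>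

definition colour :: "nat \<Rightarrow> nat \<Rightarrow> nat" where
  "colour r x = (if x = 2 * r \<or> x = 2 \<or> x = r + 2 then 2 else if 1 \<le> x \<and> x \<le> r then 0 else 1)"

lemma colour_neq:
  assumes "r \<ge> 5" "label r u v < 2" "u < v" "v \<le> 2 * r"
  shows "colour r u \<noteq> colour r v"
proof (cases "v = 2 * r")
  case True
  have "u mod r < 2" using assms True by (simp add: label_def)
  moreover have "u = u mod r \<or> u = u mod r + r"
  proof (cases "u < r")
    case False
    then have "(u - r) mod r = u - r" using assms(3) True by (intro mod_less) linarith
    then show ?thesis using False le_mod_geq[of r u] by simp
  qed simp
  \<comment> \<open>These are the neighbours of infinity; neither 2 nor r+2 is among them.\<close>
  ultimately have "u = 0 \<or> u = 1 \<or> u = r \<or> u = r + 1" by linarith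
  then have "u \<noteq> 2 * r \<and> u \<noteq> 2 \<and> u \<noteq> r + 2" using assms(1) by linarith
  then have "colour r u \<noteq> 2" by (simp add: colour_def)
  moreover have "colour r v = 2" using True by (simp add: colour_def)
  ultimately show ?thesis by simp
next
  case False
  then have "(u + v) mod (2 * r) div 2 < 2" using assms(2-4) by (simp add: label_def)
  then have small: "(u + v) mod (2 * r) < 4" by linarith
  show ?thesis
  proof (cases "u + v < 2 * r")
    case True
    then have "u + v < 4" using small by simp
    then have "u = 0 \<and> v = 1 \<or> u = 0 \<and> v = 2 \<or> u = 0 \<and> v = 3 \<or> u = 1 \<and> v = 2"
      using assms(3) by linarith
    then show ?thesis using assms(1) by (elim disjE) (simp_all add: colour_def)
  next
    case ge: False
    then have "(u + v - 2 * r) mod (2 * r) = u + v - 2 * r"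
      using assms(3,4) False by (intro mod_less) linarith
    then have "(u + v) mod (2 * r) = u + v - 2 * r"
      using ge le_mod_geq[of "2 * r" "u + v"] by linarith
    then have sum: "2 * r \<le> u + v" "u + v < 2 * r + 4"
      using small ge by linarith+
    show ?thesis
    proof (cases "u \<le> r")
      case True
      then have "r < v" "1 \<le> u" "v < 2 * r" using sum assms(3,4) False by linarith+
      \<comment> \<open>The recoloured columns are not adjacent: r + 4 < 2r because r \<ge>
        5.\<close>
      moreover have "v \<noteq> r + 2" if "u = 2" using sum that assms(1) by linarith
      moreover have "u \<noteq> 2 * r" "u \<noteq> r + 2" "v \<noteq> 2" using True \<open>r < v\<close> assms(1) by linarith+
      ultimately show ?thesis using True by (cases "u = 2"; cases "v = r + 2") (simp_all add: colour_def)
    next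
      case False
      \<comment> \<open>Two distinct columns beyond \<open>r\<close> have sum at least 2r + 3, the
        largest admissible value.\<close>
      then have "u = r + 1" "v = r + 2" using sum assms(3) by linarith+
      then show ?thesis using assms(1) by (simp add: colour_def)
    qed
  qed
qed

lemma packing_three_coloured:
  assumes "r \<ge> 5"
  shows "\<exists>fs. length fs = 4 \<and> packing (2 * r + 1) ({..2 * r} \<times> (UNIV :: bool set))
    {((u, a), (v, b)). (v, u) \<in> cycle_arcs (walecki r 0) \<or> (u, v) \<in> cycle_arcs (walecki r 1)} fs"
proof -
  have r: "r > 0" using assms by simp
  have dist: "u \<noteq> v \<and> u \<le> 2 * r \<and> v \<le> 2 * r" if "(u, v) \<in> cycle_arcs (walecki r j)" for u v j
    using that cycle_arcs_irrefl[of "walecki r j" u v] cycle_arcs_subset[of "walecki r j"]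
      walecki[OF r, of j] r by auto
  have lab: "label r u v = 0" if "(u, v) \<in> cycle_arcs (walecki r 0)" for u v
    using label_walecki[OF r that] .
  have lab': "label r u v = 1" if "(u, v) \<in> cycle_arcs (walecki r 1)" for u v
    using label_walecki[OF _ that] assms by simp
  have rev: "(v, u) \<in> cycle_arcs (walecki r 0)" if "(u, v) \<in> cycle_arcs (rev (walecki r 0))" for u v
    using that cycle_arcs_rev[of "walecki r 0"] by auto
  have lab_rev: "label r u v = 0" if "(u, v) \<in> cycle_arcs (rev (walecki r 0))" for u v
    using label_commute[of r u v] lab[OF rev[OF that]] by (rule trans)
  have "colour r u \<noteq> colour r v" if "(u, v) \<in> cycle_arcs (rev (walecki r 0)) \<union> cycle_arcs (walecki r
    1)" for u v
  proof -
    have "label r u v < 2"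
      using that lab_rev[of u v] lab'[of u v] by auto
    moreover have "label r v u = label r u v"
      by (rule label_commute)
    moreover have "u \<noteq> v \<and> u \<le> 2 * r \<and> v \<le> 2 * r"
      using that rev[of u v] dist[of v u 0] dist[of u v 1] by auto
    ultimately show ?thesis
      using colour_neq[OF assms, of u v] colour_neq[OF assms, of v u]
      by (cases u v rule: linorder_cases) simp_all
  qed
  moreover have "cycle_arcs (rev (walecki r 0)) \<inter> cycle_arcs (walecki r 1) = {}"
    using lab_rev lab' by fastforce
  moreover have "colour r x < 3" for x by (simp add: colour_def)
  ultimately have "\<exists>fs. length fs = 4 \<and> packing (2 * r + 1) ({..2 * r} \<times> (UNIV :: bool set))
      {((u, a), (v, b)). (u, v) \<in> cycle_arcs (rev (walecki r 0)) \<union> cycle_arcs (walecki r 1)} fs"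
    by (intro packing_two_cycles[where col = "colour r"]) (simp_all add: walecki[OF r])
  moreover have "{((u, a :: bool), (v, b :: bool)). (u, v) \<in> cycle_arcs (rev (walecki r 0)) \<union>
    cycle_arcs (walecki r 1)}
      \<subseteq> {((u, a), (v, b)). (v, u) \<in> cycle_arcs (walecki r 0) \<or> (u, v) \<in> cycle_arcs (walecki r 1)}"
    using rev by auto
  ultimately show ?thesis by (meson packing_mono)
qed

text \<open>Five strip factors and four lifted ones; the two groups use opposite directions of each
  edge of \<open>H\<^sub>0\<close> and \<open>H\<^sub>1\<close>.\<close>

lemma packing_first_two_ge_5:
  assumes "r \<ge> 5"
  shows "\<exists>fs. length fs = 9 \<and> packing (2 * r + 1) ({..2 * r} \<times> (UNIV :: bool set))
    {((u, a), (v, b)). u = v \<or> label r u v < 2} fs"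
proof -
  have r: "r > 0" using assms by simp
  let ?E = "{((u, a :: bool), (v, b :: bool)). u = v \<or> (u, v) \<in> cycle_arcs (walecki r 0) \<or> (v, u) \<in>
    cycle_arcs (walecki r 1)}"
  let ?E' = "{((u, a :: bool), (v, b :: bool)). (v, u) \<in> cycle_arcs (walecki r 0) \<or> (u, v) \<in>
    cycle_arcs (walecki r 1)}"
  obtain fs where fs: "strip_factors r fs"
    using ex_strip_factors[OF assms] by blast
  obtain gs where gs: "length gs = 4" "packing (2 * r + 1) ({..2 * r} \<times> UNIV) ?E' gs"
    using packing_three_coloured[OF assms] by blast
  have irrefl: "u \<noteq> v" if "(u, v) \<in> cycle_arcs (walecki r j)" for u v j
    using that cycle_arcs_irrefl[of "walecki r j" u v] walecki[OF r, of j] r by auto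
  have asym: "(v, u) \<notin> cycle_arcs (walecki r j)" if "(u, v) \<in> cycle_arcs (walecki r j)" for u v j
    using that cycle_arcs_asym[of "walecki r j" u v] walecki[OF r, of j] assms by auto
  have lab: "label r u v = j" "label r v u = j" if "(u, v) \<in> cycle_arcs (walecki r j)" "j < 2" for u v j
    using label_walecki[of j r u v] label_commute[of r u v] that assms by auto
  have lab01: "label r u v < 2" if "(u, v) \<in> cycle_arcs (walecki r 0) \<union> cycle_arcs (walecki r 1)
      \<union> (cycle_arcs (walecki r 0))\<inverse> \<union> (cycle_arcs (walecki r 1))\<inverse>" for u v
    using that lab[of u v 0] lab[of u v 1] lab[of v u 0] lab[of v u 1] by auto
  have excl: "\<not> ((v, u) \<in> cycle_arcs (walecki r 0) \<or> (u, v) \<in> cycle_arcs (walecki r 1))"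
    if "u = v \<or> (u, v) \<in> cycle_arcs (walecki r 0) \<or> (v, u) \<in> cycle_arcs (walecki r 1)" for u v
    using that irrefl[of v u 0] irrefl[of u v 1] asym[of u v 0] asym[of v u 1]
      lab(1)[of u v 0] lab(1)[of u v 1] lab(1)[of v u 0] lab(1)[of v u 1] by auto
  have "?E \<inter> ?E' = {}"
  proof (rule equals0I)
    fix p assume "p \<in> ?E \<inter> ?E'"
    then show False using excl[of "fst (fst p)" "fst (snd p)"] by (simp add: split_beta)
  qed
  then have "packing (2 * r + 1) ({..2 * r} \<times> UNIV) (?E \<union> ?E')
      (map (map_prod (map (place r)) (map (place r))) fs @ gs)"
    by (rule packing_append[OF packing_strip_factors[OF fs r] gs(2)])
  then have "packing (2 * r + 1) ({..2 * r} \<times> UNIV) {((u, a), (v, b)). u = v \<or> label r u v < 2}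
      (map (map_prod (map (place r)) (map (place r))) fs @ gs)"
  proof (rule packing_mono, intro subsetI)
    fix p assume "p \<in> ?E \<union> ?E'"
    then show "p \<in> {((u, a), (v, b)). u = v \<or> label r u v < 2}"
      using lab01[of "fst (fst p)" "fst (snd p)"] by (auto simp: split_beta)
  qed
  moreover have "length (map (map_prod (map (place r)) (map (place r))) fs @ gs) = 9"
    using fs gs(1) by (simp add: strip_factors_def)
  ultimately show ?thesis by blast
qed

section \<open>Explicit factors for r = 2, 3, 4\<close>

text \<open>A number codes the column by its half and the level by its parity. Comparing the sorted
  vertex list with an interval tests distinctness and spanning at once.\<close>

lemma packing_coded:
  fixes fs :: "(nat list \<times> nat list) list"
  assumes "length fs = 9"
    and "list_all (\<lambda>(c, d). length c = 2 * r + 1 \<and> length d = 2 * r + 1 \<and> sort (c @ d) = [0..<4 * r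
      + 2]) fs"
    and "distinct (concat (map arc_list fs))"
    and "list_all (\<lambda>(u, v). u div 2 = v div 2 \<or> label r (u div 2) (v div 2) < 2) (concat (map arc_list fs))"
  shows "\<exists>fs. length fs = 9 \<and> packing (2 * r + 1) ({..2 * r} \<times> (UNIV :: bool set))
    {((u, a), (v, b)). u = v \<or> label r u v < 2} fs"
proof -
  define f where "f v = (v div 2, odd v)" for v :: nat
  have "packing (2 * r + 1) {0..<4 * r + 2} {(u, v). u div 2 = v div 2 \<or> label r (u div 2) (v div 2)
    < 2} fs"
  proof (rule packing_arc_listI)
    show "length c = 2 * r + 1 \<and> length d = 2 * r + 1 \<and> distinct (c @ d) \<and> set (c @ d) = {0..<4 * r + 2}"
      if "(c, d) \<in> set fs" for c d
    proof -
      have *: "length c = 2 * r + 1" "length d = 2 * r + 1" "sort (c @ d) = [0..<4 * r + 2]"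
        using assms(2) that by (auto simp: list_all_iff)
      then show ?thesis
        by (metis atLeastLessThan_upt distinct_sort distinct_upt set_sort)
    qed
    show "distinct (concat (map arc_list fs))" by (rule assms(3))
    show "set (concat (map arc_list fs)) \<subseteq> {(u, v). u div 2 = v div 2 \<or> label r (u div 2) (v div 2) < 2}"
      using assms(4) by (auto simp: list_all_iff)
  qed
  moreover have "inj_on f {0..<4 * r + 2}"
    by (rule inj_onI) (simp add: f_def, presburger)
  ultimately have "packing (2 * r + 1) (f ` {0..<4 * r + 2})
      (map_prod f f ` {(u, v). u div 2 = v div 2 \<or> label r (u div 2) (v div 2) < 2})
      (map (map_prod (map f) (map f)) fs)"
    by (rule packing_map)
  moreover have "f ` {0..<4 * r + 2} = {..2 * r} \<times> UNIV"
  proof -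
    have "(x, a) \<in> f ` {0..<4 * r + 2}" if "x \<le> 2 * r" for x a
      using that by (intro image_eqI[of _ f "2 * x + of_bool a"]) (auto simp: f_def)
    moreover have "f ` {0..<4 * r + 2} \<subseteq> {..2 * r} \<times> UNIV"
      by (auto simp: f_def)
    ultimately show ?thesis by auto
  qed
  ultimately have "packing (2 * r + 1) ({..2 * r} \<times> UNIV)
      {((u, a), (v, b)). u = v \<or> label r u v < 2} (map (map_prod (map f) (map f)) fs)"
    by (auto elim!: packing_mono simp: f_def)
  then show ?thesis
    using assms(1) by (intro exI[of _ "map (map_prod (map f) (map f)) fs"]) simp
qed

text \<open>For r = 2 every label is below 2, so these nine factors already exhaust the complete
  digraph on ten vertices.\<close>

lemma packing_first_two_2:
  "\<exists>fs. length fs = 9 \<and> packing (2 * 2 + 1) ({..2 * 2} \<times> (UNIV :: bool set))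
    {((u, a), (v, b)). u = v \<or> label 2 u v < 2} fs"
  by (rule packing_coded[of
     "[([0, 3, 9, 2, 6], [1, 8, 7, 4, 5]),
      ([0, 2, 1, 5, 8], [3, 7, 6, 9, 4]),
      ([0, 5, 4, 1, 9], [2, 3, 8, 6, 7]),
      ([0, 7, 8, 2, 4], [1, 3, 5, 9, 6]),
      ([0, 9, 5, 6, 2], [1, 7, 3, 4, 8]),
      ([0, 6, 4, 7, 1], [2, 9, 8, 5, 3]),
      ([0, 8, 4, 6, 3], [1, 2, 5, 7, 9]),
      ([0, 1, 4, 9, 7], [2, 8, 3, 6, 5]),
      ([0, 4, 2, 7, 5], [1, 6, 8, 9, 3])]"])
    (simp_all add: upt_rec arc_list_def label_def)

lemma packing_first_two_3:
  "\<exists>fs. length fs = 9 \<and> packing (2 * 3 + 1) ({..2 * 3} \<times> (UNIV :: bool set))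
    {((u, a), (v, b)). u = v \<or> label 3 u v < 2} fs"
  by (rule packing_coded[of
     "[([0, 3, 12, 1, 5, 8, 7], [2, 13, 9, 10, 6, 11, 4]),
      ([0, 7, 11, 9, 13, 1, 6], [2, 4, 5, 10, 8, 12, 3]),
      ([0, 1, 3, 10, 11, 5, 2], [4, 8, 13, 12, 7, 6, 9]),
      ([0, 5, 1, 7, 9, 12, 13], [2, 3, 4, 11, 8, 6, 10]),
      ([0, 13, 7, 8, 4, 3, 5], [1, 12, 2, 10, 9, 11, 6]),
      ([0, 2, 12, 6, 7, 1, 4], [3, 13, 8, 9, 5, 11, 10]),
      ([0, 4, 10, 7, 13, 6, 12], [1, 2, 5, 9, 8, 11, 3]),
      ([0, 12, 9, 6, 8, 5, 3], [1, 13, 2, 11, 7, 10, 4]),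
      ([0, 6, 13, 3, 11, 2, 1], [4, 9, 7, 12, 8, 10, 5])]"])
    (simp_all add: upt_rec arc_list_def label_def)

lemma packing_first_two_4:
  "\<exists>fs. length fs = 9 \<and> packing (2 * 4 + 1) ({..2 * 4} \<times> (UNIV :: bool set))
    {((u, a), (v, b)). u = v \<or> label 4 u v < 2} fs"
  by (rule packing_coded[of
     "[([2, 3, 1, 7, 13, 10, 8, 15, 5], [0, 16, 11, 17, 9, 14, 4, 12, 6]),
      ([2, 0, 17, 8, 11, 7, 6, 14, 3], [1, 16, 10, 9, 13, 12, 5, 15, 4]),
      ([2, 1, 6, 11, 8, 17, 16, 9, 15], [3, 0, 5, 14, 7, 12, 10, 13, 4]),
      ([2, 4, 13, 5, 3, 16, 1, 17, 0], [14, 6, 7, 15, 9, 10, 11, 12, 8]),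
      ([2, 5, 1, 3, 14, 15, 7, 0, 4], [6, 12, 13, 11, 9, 8, 16, 17, 10]),
      ([2, 14, 5, 12, 7, 11, 10, 17, 1], [3, 4, 0, 6, 15, 8, 13, 9, 16]),
      ([2, 15, 6, 13, 8, 10, 12, 11, 16], [3, 5, 0, 7, 1, 4, 14, 9, 17]),
      ([2, 16, 0, 1, 5, 4, 15, 3, 17], [14, 8, 12, 9, 11, 13, 6, 10, 7]),
      ([2, 17, 11, 6, 1, 0, 3, 15, 14], [4, 5, 13, 7, 10, 16, 8, 9, 12])]"])
    (simp_all add: upt_rec arc_list_def label_def)

section \<open>Assembling the factorization\<close>

lemma packing_first_two:
  assumes "r \<ge> 2"
  shows "\<exists>fs. length fs = 9 \<and> packing (2 * r + 1) ({..2 * r} \<times> (UNIV :: bool set))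
    {((u, a), (v, b)). u = v \<or> label r u v < 2} fs"
proof -
  consider "r = 2" | "r = 3" | "r = 4" | "r \<ge> 5" using assms by linarith
  then show ?thesis
    using packing_first_two_2 packing_first_two_3 packing_first_two_4 packing_first_two_ge_5 by
      cases simp_all
qed

theorem theorem3:
  fixes m :: nat
  assumes "odd m" and "m \<ge> 5"
  shows "has_Cm_factorization m {0..<2*m} (complete_sym_digraph {0..<2*m})"
proof -
  obtain r where m: "m = 2 * r + 1" using assms(1) by (auto elim: oddE)
  have r: "r \<ge> 2" using assms(2) m by simp
  let ?V = "{..2 * r} \<times> (UNIV :: bool set)"
  \<comment> \<open>Arcs are sorted by label: labels 0 and 1 together with the arcs inside columns,
    then each larger label by itself.\<close>
  let ?E = "{((u, a :: bool), (v, b :: bool)). u = v \<or> label r u v < 2}"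
  let ?F = "\<lambda>j. {((u, a :: bool), (v, b :: bool)). u \<noteq> v \<and> label r u v = j}"
  obtain fs where fs: "length fs = 9" "packing m ?V ?E fs"
    using packing_first_two[OF r] m by auto
  have "\<forall>j\<in>set [2..<r]. \<exists>gs. length gs = 4 \<and> packing m ?V (?F j) gs"
    using packing_walecki[of _ r] m by auto
  from bchoice[OF this] obtain g
    where g: "\<forall>j\<in>set [2..<r]. length (g j) = 4 \<and> packing m ?V (?F j) (g j)" by blast
  define hs where "hs = fs @ concat (map g [2..<r])"
  have "packing m ?V (\<Union>j\<in>set [2..<r]. ?F j) (concat (map g [2..<r]))"
    using g by (intro packing_concat) (simp_all, blast)
  moreover have "?E \<inter> (\<Union>j\<in>set [2..<r]. ?F j) = {}" by auto
  \<comment> \<open>The arc bound stays anonymous, since completeness comes from counting.\<close>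
  ultimately obtain E where hs: "packing m ?V E hs"
    using packing_append[OF fs(2)] unfolding hs_def by blast
  define f :: "nat \<times> bool \<Rightarrow> nat" where "f = (\<lambda>(x, a). 2 * x + of_bool a)"
  have inj: "inj_on f ?V"
  proof (rule inj_onI)
    fix p q assume "f p = f q"
    then show "p = q"
      by (cases p; cases q; cases "snd p"; cases "snd q") (simp_all add: f_def, presburger+)
  qed
  have pack: "packing m (f ` ?V) (map_prod f f ` E) (map (map_prod (map f) (map f)) hs)"
    using hs inj by (rule packing_map)
  have "f ` ?V \<subseteq> {0..<2 * m}"
    by (auto simp: f_def m)
  moreover have card: "card (f ` ?V) = 2 * m"
    by (simp add: card_image[OF inj] m card_cartesian_product)
  ultimately have V: "f ` ?V = {0..<2 * m}"
    by (intro card_subset_eq) simp_all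
  have "length (concat (map g [2..<r])) = (\<Sum>j\<leftarrow>[2..<r]. 4)"
    unfolding length_concat map_map using g by (intro arg_cong[of _ _ sum_list] map_cong) simp_all
  also have "\<dots> = 4 * (r - 2)"
    by (simp add: sum_list_triv)
  \<comment> \<open>The count is 9 + 4(r - 2) = 4r + 1 = 2m - 1.\<close>
  finally have "length (map (map_prod (map f) (map f)) hs) = 2 * m - 1"
    using fs(1) r m by (simp add: hs_def)
  from packing_imp_factorization[OF pack this] show ?thesis
    unfolding V using assms(2) by simp
qed

end
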